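(* Let $m<n\leq p<\omega$ and $\varepsilon>0$, let $X$ be a set with $|X|\geq\aleph_{p-1}$, and let $T:C(\sigma_m(2^X))\to C(\sigma_n(2^X))$ be any extension operator. Then there exists a set $Y\subset X$ with $|Y|=p$ such that $\|T|_Y-T_Y\|<\varepsilon$, where $T|_Y$ is the restricted operator and $T_Y$ is the canonical extension operator $C(\sigma_m(2^Y))\to C(\sigma_n(2^Y))$ (both as defined in the context).
   Context: For a set $X$ and a natural number $n$, $\sigma_n(2^X)=\{\chi_A\in\{0,1\}^X : A\subset X,\ |A|\le n\}$, where $\chi_A$ is the characteristic function of $A$, with the topology inherited from the product space $\{0,1\}^X$; it is compact. For a compact Hausdorff space $K$, $C(K)$ is the Banach space of continuous real-valued functions on $K$ with the supremum norm. If $L\subset K$ is a closed subspace, a bounded linear operator $T:C(L)\to C(K)$ is an extension operator if $(Tf)|_L=f$ for every $f\in C(L)$. Canonical operator: for $m<n$ and any set $Y$, with $[A]^{\le m}=\{B\subset A:|B|\le m\}$, the operator $T_Y:C(\sigma_m(2^Y))\to C(\sigma_n(2^Y))$ is given by $$T_Y(f)(\chi_A)=\sum_{B\in[A]^{\le m}}(-1)^{m-|B|}\binom{|A|-|B|-1}{m-|B|}f(\chi_B)\quad\text{if }m<|A|\le n,$$ and $T_Y(f)(\chi_A)=f(\chi_A)$ if $|A|\le m$. Restricted operator: for $Y\subset X$, let $e_Y^X:C(\sigma_m(2^Y))\to C(\sigma_m(2^X))$ be $e_Y^X(f)(\chi_A)=f(\chi_{A\cap Y})$ and let $r_Y^X:C(\sigma_n(2^X))\to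 C(\sigma_n(2^Y))$ be the restriction $r_Y^X(g)(\chi_A)=g(\chi_A)$ for $A\subset Y$. For an extension operator $T:C(\sigma_m(2^X))\to C(\sigma_n(2^X))$, put $T|_Y=r_Y^X\circ T\circ e_Y^X:C(\sigma_m(2^Y))\to C(\sigma_n(2^Y))$. The norm is the operator norm. *)

theory Defs
  imports "HOL-Analysis.Analysis"
begin

unbundle cardinal_syntax
  \<comment> \<open>the membership notation of \<open>Set_Algebras\<close> clashes with cardinal equality \<open>=o\<close>\<close>
no_notation elt_set_eq (infix \<open>=o\<close> 50)

section \<open>Spaces of continuous functions and operators between them\<close>

text \<open>Elements of \<open>C(K)\<close> are extensional, i.e. \<^term>\<open>undefined\<close> outside \<^term>\<open>topspace K\<close>, so that
  equality in \<open>C(K)\<close> is equality in HOL. Suprema below are over the reals; they are meaningful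
  because the definitions are only used for nonempty compact spaces and bounded operators.\<close>

definition cont_space :: "'a topology \<Rightarrow> ('a \<Rightarrow> real) set" where
  "cont_space K = {f \<in> extensional (topspace K). continuous_map K euclideanreal f}"

definition sup_norm :: "'a topology \<Rightarrow> ('a \<Rightarrow> real) \<Rightarrow> real" where
  "sup_norm K f = (SUP x\<in>topspace K. \<bar>f x\<bar>)"

definition bounded_operator ::
    "'a topology \<Rightarrow> 'b topology \<Rightarrow> (('a \<Rightarrow> real) \<Rightarrow> ('b \<Rightarrow> real)) \<Rightarrow> bool" where
  "bounded_operator L K T \<longleftrightarrow>
     (\<forall>f\<in>cont_space L. T f \<in> cont_space K) \<and>
     (\<forall>f\<in>cont_space L. \<forall>g\<in>cont_space L.
        T (\<lambda>x\<in>topspace L. f x + g x) = (\<lambda>y\<in>topspace K. T f y + T g y)) \<and>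
     (\<forall>c. \<forall>f\<in>cont_space L.
        T (\<lambda>x\<in>topspace L. c * f x) = (\<lambda>y\<in>topspace K. c * T f y)) \<and>
     (\<exists>M. \<forall>f\<in>cont_space L. sup_norm K (T f) \<le> M * sup_norm L f)"

definition operator_norm ::
    "'a topology \<Rightarrow> 'b topology \<Rightarrow> (('a \<Rightarrow> real) \<Rightarrow> ('b \<Rightarrow> real)) \<Rightarrow> real" where
  "operator_norm L K T = (SUP f\<in>{f \<in> cont_space L. sup_norm L f \<le> 1}. sup_norm K (T f))"

definition operator_diff ::
    "'b topology \<Rightarrow> (('a \<Rightarrow> real) \<Rightarrow> ('b \<Rightarrow> real)) \<Rightarrow> (('a \<Rightarrow> real) \<Rightarrow> ('b \<Rightarrow> real))
      \<Rightarrow> (('a \<Rightarrow> real) \<Rightarrow> ('b \<Rightarrow> real))" where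
  "operator_diff K S T = (\<lambda>f. \<lambda>y\<in>topspace K. S f y - T f y)"

definition extension_operator ::
    "'a topology \<Rightarrow> 'a topology \<Rightarrow> (('a \<Rightarrow> real) \<Rightarrow> ('a \<Rightarrow> real)) \<Rightarrow> bool" where
  "extension_operator L K T \<longleftrightarrow>
     closedin K (topspace L) \<and> L = subtopology K (topspace L) \<and>
     bounded_operator L K T \<and>
     (\<forall>f\<in>cont_space L. restrict (T f) (topspace L) = f)"


section \<open>The spaces \<open>\<sigma>\<^sub>n(2\<^sup>X)\<close>\<close>

text \<open>A point of \<open>{0,1}\<^sup>X\<close> is extensional on \<^term>\<open>X\<close>, so the characteristic function of a
  set depends on the ambient set: \<open>chi X A\<close> and \<open>chi Y A\<close> differ for \<open>A \<subseteq> Y \<subset> X\<close>.\<close>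

definition chi :: "'a set \<Rightarrow> 'a set \<Rightarrow> ('a \<Rightarrow> nat)" where
  "chi X A = (\<lambda>x\<in>X. indicator A x)"

text \<open>The subset of \<^term>\<open>X\<close> of which a point of \<open>{0,1}\<^sup>X\<close> is the characteristic function.\<close>

definition chi_set :: "'a set \<Rightarrow> ('a \<Rightarrow> nat) \<Rightarrow> 'a set" where
  "chi_set X z = {x \<in> X. z x = 1}"

definition cantor_cube :: "'a set \<Rightarrow> ('a \<Rightarrow> nat) topology" where
  "cantor_cube X = product_topology (\<lambda>_. discrete_topology {0, 1}) X"

definition sigma_set :: "nat \<Rightarrow> 'a set \<Rightarrow> ('a \<Rightarrow> nat) set" where
  "sigma_set n X = {chi X A |A. A \<subseteq> X \<and> finite A \<and> card A \<le> n}"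

definition sigma_space :: "nat \<Rightarrow> 'a set \<Rightarrow> ('a \<Rightarrow> nat) topology" where
  "sigma_space n X = subtopology (cantor_cube X) (sigma_set n X)"


section \<open>The canonical and the restricted operators\<close>

definition canonical_operator ::
    "nat \<Rightarrow> nat \<Rightarrow> 'a set \<Rightarrow> (('a \<Rightarrow> nat) \<Rightarrow> real) \<Rightarrow> (('a \<Rightarrow> nat) \<Rightarrow> real)" where
  "canonical_operator m n Y f = (\<lambda>z\<in>sigma_set n Y.
     let A = chi_set Y z in
     if card A \<le> m then f (chi Y A)
     else \<Sum>B\<in>{B. B \<subseteq> A \<and> card B \<le> m}.
       (-1) ^ (m - card B) * real ((card A - card B - 1) choose (m - card B)) * f (chi Y B))"

definition inflate ::
    "nat \<Rightarrow> 'a set \<Rightarrow> 'a set \<Rightarrow> (('a \<Rightarrow> nat) \<Rightarrow> real) \<Rightarrow> (('a \<Rightarrow> nat) \<Rightarrow> real)" where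
  "inflate m X Y f = (\<lambda>z\<in>sigma_set m X. f (chi Y (chi_set X z \<inter> Y)))"

definition deflate ::
    "nat \<Rightarrow> 'a set \<Rightarrow> 'a set \<Rightarrow> (('a \<Rightarrow> nat) \<Rightarrow> real) \<Rightarrow> (('a \<Rightarrow> nat) \<Rightarrow> real)" where
  "deflate n X Y g = (\<lambda>z\<in>sigma_set n Y. g (chi X (chi_set Y z)))"

definition restricted_operator ::
    "nat \<Rightarrow> nat \<Rightarrow> 'a set \<Rightarrow> 'a set \<Rightarrow>
      ((('a \<Rightarrow> nat) \<Rightarrow> real) \<Rightarrow> (('a \<Rightarrow> nat) \<Rightarrow> real)) \<Rightarrow>
      ((('a \<Rightarrow> nat) \<Rightarrow> real) \<Rightarrow> (('a \<Rightarrow> nat) \<Rightarrow> real))" where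
  "restricted_operator m n X Y T = deflate n X Y \<circ> T \<circ> inflate m X Y"


section \<open>The cardinals \<open>\<aleph>\<^sub>k\<close> for finite \<open>k\<close>\<close>

text \<open>\<^const>\<open>cardSuc\<close> raises the type, so \<open>\<aleph>\<^sub>k\<close> is given as a predicate on relations over a
  fixed type. The predicate determines the cardinal up to \<open>=o\<close>, across types
  (\<open>is_aleph_unique\<close>), and it is satisfiable on every type containing a set of
  cardinality at least \<open>\<aleph>\<^sub>k\<close> (\<open>is_aleph_exists\<close>).\<close>

primrec is_aleph :: "nat \<Rightarrow> 'a rel \<Rightarrow> bool" where
  "is_aleph 0 r \<longleftrightarrow> r =o natLeq"
| "is_aleph (Suc k) r \<longleftrightarrow> (\<exists>s :: 'a rel. is_aleph k s \<and> r =o cardSuc s)"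

definition card_ge_aleph :: "nat \<Rightarrow> 'a set \<Rightarrow> bool" where
  "card_ge_aleph k X \<longleftrightarrow> (\<exists>r :: 'a rel. is_aleph k r \<and> r \<le>o |X| )"

lemma is_aleph_Card_order: "is_aleph k r \<Longrightarrow> Card_order r"
proof (induction k arbitrary: r)
  case 0
  then show ?case
    using Card_order_ordIso[OF natLeq_Card_order] by simp
next
  case (Suc k)
  then obtain s :: "'a rel" where "is_aleph k s" "r =o cardSuc s"
    by auto
  then show ?case
    using Card_order_ordIso[OF cardSuc_Card_order] Suc.IH by blast
qed

lemma is_aleph_unique:
  fixes r :: "'a rel" and s :: "'b rel"
  assumes "is_aleph k r" "is_aleph k s"
  shows "r =o s"
  using assms
proof (induction k arbitrary: r s)
  case 0
  then show ?case
    using ordIso_transitive[OF _ ordIso_symmetric, of r natLeq s] by simp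
next
  case (Suc k)
  then obtain r' :: "'a rel" and s' :: "'b rel" where
    *: "is_aleph k r'" "r =o cardSuc r'" "is_aleph k s'" "s =o cardSuc s'"
    by auto
  then have "cardSuc r' =o cardSuc s'"
    using Suc.IH[OF *(1,3)] cardSuc_invar_ordIso[OF *(1,3)[THEN is_aleph_Card_order]] by simp
  then show ?case
    by (rule ordIso_transitive[OF *(2) ordIso_transitive[OF _ ordIso_symmetric[OF *(4)]]])
qed

lemma is_aleph_exists:
  fixes s :: "'b rel" and X :: "'a set"
  assumes "is_aleph k s" "s \<le>o |X|"
  shows "\<exists>r :: 'a rel. is_aleph k r \<and> r =o s"
  using assms
proof (induction k arbitrary: s)
  case (0 s)
  obtain r :: "'a rel" where "s =o r"
    using internalize_ordLeq[of s "|X|"] 0(2) by blast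
  then have r: "r =o s"
    by (rule ordIso_symmetric)
  moreover have "r =o natLeq"
    using ordIso_transitive[OF r] 0(1) by simp
  ultimately show ?case
    by auto
next
  case (Suc k s)
  obtain r :: "'a rel" where r: "s =o r"
    using internalize_ordLeq[of s "|X|"] Suc.prems(2) by blast
  obtain t :: "'b rel" where t: "is_aleph k t" "s =o cardSuc t"
    using Suc.prems(1) by auto
  note ct = is_aleph_Card_order[OF t(1)]
  have "cardSuc t \<le>o |X|"
    using ordIso_ordLeq_trans[OF ordIso_symmetric[OF t(2)] Suc.prems(2)] .
  then have "t \<le>o |X|"
    by (rule ordLeq_transitive[OF cardSuc_ordLeq[OF ct]])
  with Suc.IH t(1) obtain u :: "'a rel" where u: "is_aleph k u" "u =o t"
    by blast
  have "cardSuc t =o cardSuc u"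
    using cardSuc_invar_ordIso[OF ct is_aleph_Card_order[OF u(1)]] ordIso_symmetric[OF u(2)]
    by simp
  then have "r =o cardSuc u"
    by (rule ordIso_transitive[OF ordIso_symmetric[OF r] ordIso_transitive[OF t(2)]])
  then show ?case
    using u(1) ordIso_symmetric[OF r] by auto
qed


section \<open>Basic facts\<close>

lemma chi_set_chi:
  assumes "A \<subseteq> X"
  shows "chi_set X (chi X A) = A"
proof -
  have "chi X A x = 1 \<longleftrightarrow> x \<in> A" if "x \<in> X" for x
    using that by (simp add: chi_def indicator_def)
  with assms show ?thesis
    unfolding chi_set_def by blast
qed

lemma chi_in_sigma_set:
  assumes "A \<subseteq> X"
  shows "chi X A \<in> sigma_set n X \<longleftrightarrow> finite A \<and> card A \<le> n"
proof
  assume "chi X A \<in> sigma_set n X"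
  then obtain B where B: "chi X A = chi X B" "B \<subseteq> X" "finite B" "card B \<le> n"
    by (auto simp: sigma_set_def)
  have "A = B"
    using chi_set_chi[OF assms] chi_set_chi[OF B(2)] B(1) by metis
  with B show "finite A \<and> card A \<le> n"
    by simp
next
  assume "finite A \<and> card A \<le> n"
  with assms show "chi X A \<in> sigma_set n X"
    unfolding sigma_set_def by blast
qed

lemma sigma_set_mono: "m \<le> n \<Longrightarrow> sigma_set m X \<subseteq> sigma_set n X"
  by (force simp: sigma_set_def)

lemma sigma_set_subset_cantor_cube: "sigma_set n X \<subseteq> topspace (cantor_cube X)"
  by (auto simp: sigma_set_def cantor_cube_def chi_def indicator_def)

lemma topspace_sigma_space [simp]: "topspace (sigma_space n X) = sigma_set n X"
  using sigma_set_subset_cantor_cube[of n X] by (auto simp: sigma_space_def)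

lemma subtopology_sigma_space:
  "m \<le> n \<Longrightarrow> sigma_space m X = subtopology (sigma_space n X) (sigma_set m X)"
  using sigma_set_mono[of m n X] by (simp add: sigma_space_def subtopology_subtopology Int_absorb1)

lemma sigma_set_iff:
  assumes "z \<in> topspace (cantor_cube X)"
  shows "z \<in> sigma_set n X \<longleftrightarrow> finite (chi_set X z) \<and> card (chi_set X z) \<le> n"
proof -
  have "z = chi X (chi_set X z)"
  proof (rule extensionalityI[where A = X])
    show "z \<in> extensional X"
      using assms by (simp add: cantor_cube_def PiE_def)
    show "chi X (chi_set X z) \<in> extensional X"
      by (simp add: chi_def)
    show "z x = chi X (chi_set X z) x" if "x \<in> X" for x
    proof -
      have "z x \<in> {0, 1}"
        using assms that PiE_mem[of z X "\<lambda>_. {0, 1}" x] by (simp add: cantor_cube_def)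
      with that show ?thesis
        by (auto simp: chi_def chi_set_def)
    qed
  qed
  moreover have "chi_set X z \<subseteq> X"
    by (auto simp: chi_set_def)
  ultimately show ?thesis
    using chi_in_sigma_set[of "chi_set X z" X n] by simp
qed

lemma closedin_sigma_set: "closedin (cantor_cube X) (sigma_set n X)"
proof -
  have "openin (cantor_cube X) (topspace (cantor_cube X) - sigma_set n X)"
  proof (subst openin_subopen, intro ballI)
    fix z assume z: "z \<in> topspace (cantor_cube X) - sigma_set n X"
    then have "\<not> (finite (chi_set X z) \<and> card (chi_set X z) \<le> n)"
      using sigma_set_iff by blast
    then obtain F where F: "F \<subseteq> chi_set X z" "finite F" "card F = Suc n"
      using infinite_arbitrarily_large[of "chi_set X z" "Suc n"]
        obtain_subset_with_card_n[of "Suc n" "chi_set X z"] not_less_eq_eq by metis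
    define U where "U = (\<Pi>\<^sub>E x\<in>X. if x \<in> F then {1} else {0, 1::nat})"
    have "openin (cantor_cube X) U"
      unfolding cantor_cube_def U_def
    proof (rule product_topology_basis)
      show "finite {x. (if x \<in> F then {1} else {0, 1::nat}) \<noteq> topspace (discrete_topology {0, 1})}"
        by (rule finite_subset[OF _ F(2)]) auto
    qed simp
    moreover have "z \<in> U"
    proof -
      have "z x \<in> (if x \<in> F then {1} else {0, 1})" if "x \<in> X" for x
        using z F(1) that PiE_mem[of z X "\<lambda>_. {0, 1}" x] by (auto simp: cantor_cube_def chi_set_def)
      moreover have "z \<in> extensional X"
        using z by (simp add: cantor_cube_def PiE_def)
      ultimately show ?thesis
        by (auto simp: U_def PiE_def)
    qed
    moreover have "U \<subseteq> topspace (cantor_cube X) - sigma_set n X"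
    proof
      fix w assume w: "w \<in> U"
      have wt: "w \<in> topspace (cantor_cube X)"
        using w \<open>openin (cantor_cube X) U\<close> openin_subset by blast
      have "F \<subseteq> X"
        using F by (auto simp: chi_set_def)
      have "F \<subseteq> chi_set X w"
      proof
        fix x assume "x \<in> F"
        with \<open>F \<subseteq> X\<close> w show "x \<in> chi_set X w"
          unfolding U_def chi_set_def by (auto dest: PiE_mem[where x = x])
      qed
      then have "\<not> (finite (chi_set X w) \<and> card (chi_set X w) \<le> n)"
        using F(3) card_mono[of "chi_set X w" F] by auto
      with wt show "w \<in> topspace (cantor_cube X) - sigma_set n X"
        using sigma_set_iff by blast
    qed
    ultimately show "\<exists>T. openin (cantor_cube X) T \<and> z \<in> T \<and>
        T \<subseteq> topspace (cantor_cube X) - sigma_set n X"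
      by blast
  qed
  then show ?thesis
    using sigma_set_subset_cantor_cube by (simp add: closedin_def)
qed

lemma compact_sigma_space: "compact_space (sigma_space n X)"
proof -
  have "compact_space (cantor_cube X)"
    by (simp add: cantor_cube_def compact_space_product_topology compact_space_discrete_topology)
  then show ?thesis
    using closedin_sigma_set closedin_compact_space compact_space_subtopology
    unfolding sigma_space_def by blast
qed

lemma closedin_sigma_space: "m \<le> n \<Longrightarrow> closedin (sigma_space n X) (topspace (sigma_space m X))"
  using closedin_subset_topspace[OF closedin_sigma_set sigma_set_mono]
  by (simp add: sigma_space_def[of n])

lemma canonical_operator_chi:
  assumes "A \<subseteq> Y" "finite A" "card A \<le> n"
  shows "canonical_operator m n Y f (chi Y A) =
    (if card A \<le> m then f (chi Y A)
     else \<Sum>B\<in>{B. B \<subseteq> A \<and> card B \<le> m}.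
       (-1) ^ (m - card B) * real ((card A - card B - 1) choose (m - card B)) * f (chi Y B))"
  using assms by (simp add: canonical_operator_def chi_in_sigma_set chi_set_chi Let_def)

lemma inflate_chi:
  assumes "A \<subseteq> X" "finite A" "card A \<le> m"
  shows "inflate m X Y f (chi X A) = f (chi Y (A \<inter> Y))"
  using assms by (simp add: inflate_def chi_in_sigma_set chi_set_chi)

lemma deflate_chi:
  assumes "A \<subseteq> Y" "finite A" "card A \<le> n"
  shows "deflate n X Y g (chi Y A) = g (chi X A)"
  using assms by (simp add: deflate_def chi_in_sigma_set chi_set_chi)

end

theory Submission
  imports Defs
begin

text \<open>
  On \<open>\<sigma>\<^sub>m(2\<^sup>Y)\<close>, for finite \<open>Y\<close>, every function is a combination of the monomials
  \<open>e\<^sub>D(\<chi>\<^sub>A) = [D \<subseteq> A]\<close> with \<open>D \<subseteq> Y\<close> and \<open>|D| \<le> m\<close>; the coefficients are given by Moebius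
  inversion. In this basis both operators are transparent. The canonical operator sends \<open>e\<^sub>D\<close> to
  the function given by the same formula \<open>[D \<subseteq> A]\<close> on \<open>\<sigma>\<^sub>n(2\<^sup>Y)\<close>: it extends a polynomial of
  degree at most \<open>m\<close> by the same polynomial, and its binomial coefficients are partial
  alternating sums of a row of Pascal's triangle (\<open>canonical_operator_moebius\<close>). The inflation to
  \<open>X\<close> sends \<open>e\<^sub>D\<close> to the monomial \<open>e\<^sub>D\<close> on \<open>\<sigma>\<^sub>m(2\<^sup>X)\<close>, because \<open>D \<subseteq> A \<inter> Y\<close> and \<open>D \<subseteq> A\<close> are
  equivalent for \<open>D \<subseteq> Y\<close>; so the function to which \<open>T\<close> is applied does not depend on \<open>Y\<close>.

  It remains to find \<open>Y\<close> such that \<open>T e\<^sub>D(\<chi>\<^sub>A)\<close> is close to \<open>[D \<subseteq> A]\<close> for all small \<open>D\<close> and \<open>A\<close>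
  in \<open>Y\<close>. By compactness \<open>T e\<^sub>D\<close> depends, up to a small error, only on the trace of \<open>A\<close> on some
  finite set \<open>F D\<close>. If \<open>F D \<inter> Y \<subseteq> D\<close>, then within \<open>Y\<close> only the trace on \<open>D\<close> matters, and this
  trace has at most \<open>m\<close> elements, so that there the extension property gives the value of
  \<open>T e\<^sub>D\<close> exactly (\<open>extension_operator_monomial_approx\<close>). A set \<open>Y\<close> with \<open>p\<close> elements and
  \<open>F D \<inter> Y \<subseteq> D\<close> for all small \<open>D \<subseteq> Y\<close> is a free set for the set mapping \<open>F\<close>, and the cardinal
  \<open>\<aleph>\<^bsub>p-1\<^esub>\<close> is what Kuratowski's free set theorem asks for (\<open>Kuratowski_free_set\<close>).
  The coefficients are at most \<open>2\<^sup>p\<close> in absolute value for functions in the unit ball and there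
  are at most \<open>2\<^sup>p\<close> of them, so an error below \<open>\<epsilon> / (2 \<cdot> 4\<^sup>p)\<close> for each monomial suffices.
\<close>

section \<open>Free sets for set mappings\<close>

lemma infinite_Field_is_aleph: "is_aleph k r \<Longrightarrow> infinite (Field r)"
proof (induction k arbitrary: r)
  case 0
  then have "natLeq \<le>o |Field r|"
    by (metis card_of_Field_ordIso is_aleph.simps(1) is_aleph_Card_order ordIso_iff_ordLeq
        ordIso_ordLeq_trans ordIso_symmetric)
  then show ?case
    using infinite_iff_natLeq_ordLeq by blast
next
  case (Suc k)
  then obtain s :: "'a rel" where s: "is_aleph k s" "r =o cardSuc s"
    by auto
  have "s \<le>o r"
    using cardSuc_ordLeq[OF is_aleph_Card_order[OF s(1)]] s(2) ordIso_symmetric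
      ordLeq_ordIso_trans by blast
  then have "|Field s| \<le>o |Field r|"
    by (rule card_of_mono2)
  then show ?case
    using Suc.IH[OF s(1)] card_of_ordLeq_infinite by blast
qed

lemma card_of_subsets_of_card_ordLeq:
  assumes "infinite Z"
  shows "|{C. C \<subseteq> Z \<and> finite C \<and> card C = k}| \<le>o |Z|"
proof (induction k)
  case 0
  have "{C. C \<subseteq> Z \<and> finite C \<and> card C = 0} = {{}}"
    by auto
  moreover have "|{{} :: 'a set}| \<le>o |Z|"
    using assms by (metis card_of_ordLeq_finite card_of_Well_order finite.emptyI finite.insertI
        ordLeq_total)
  ultimately show ?case
    by simp
next
  case (Suc k)
  let ?P = "\<lambda>k. {C. C \<subseteq> Z \<and> finite C \<and> card C = k}"
  have "?P (Suc k) \<subseteq> (\<lambda>(z, C). insert z C) ` (Z \<times> ?P k)"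
  proof
    fix C assume "C \<in> ?P (Suc k)"
    then obtain z D where "C = insert z D" "z \<notin> D" "card D = k" "C \<subseteq> Z" "finite C"
      by (auto simp: card_Suc_eq)
    then show "C \<in> (\<lambda>(z, C). insert z C) ` (Z \<times> ?P k)"
      by (intro image_eqI[of _ _ "(z, D)"]) auto
  qed
  then have "|?P (Suc k)| \<le>o |(\<lambda>(z, C). insert z C) ` (Z \<times> ?P k)|"
    by (rule card_of_mono1)
  also have "|(\<lambda>(z, C). insert z C) ` (Z \<times> ?P k)| \<le>o |Z \<times> ?P k|"
    by (rule card_of_image)
  also have "|Z \<times> ?P k| \<le>o |Z|"
    using card_of_Times_ordLeq_infinite_Field[of "|Z|", OF _ card_of_mono1[OF subset_refl] Suc.IH
        card_of_Card_order] assms by (simp add: Field_card_of)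
  finally show ?case .
qed

text \<open>
  The induction on \<open>k\<close> chooses a subset \<open>Z\<close> of size \<open>\<aleph>\<^sub>k\<close> first. It has only \<open>\<aleph>\<^sub>k\<close> many subsets
  with \<open>k + 1\<close> elements, each contributing a finite value of \<open>F\<close>, so in the larger
  set \<open>X\<close> some \<open>y\<close> outside \<open>Z\<close> lies in
  none of these values. Applying the induction hypothesis inside \<open>Z\<close> to the mapping
  \<open>D \<mapsto> F (insert y D)\<close> gives a set that remains free when \<open>y\<close> is added.
\<close>

lemma Kuratowski_free_set:
  fixes F :: "'a set \<Rightarrow> 'a set" and r :: "'a rel"
  assumes "is_aleph k r" and "r \<le>o |X|"
    and "\<And>C. C \<subseteq> X \<Longrightarrow> finite C \<Longrightarrow> finite (F C)"
  shows "\<exists>Y\<subseteq>X. card Y = Suc k \<and> (\<forall>y\<in>Y. y \<notin> F (Y - {y}))"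
  using assms
proof (induction k arbitrary: r X F)
  case (0 r X F)
  have "|Field r| \<le>o |X|"
    using card_of_mono2[OF 0(2)] by (simp add: Field_card_of)
  then have "infinite X"
    using infinite_Field_is_aleph[OF 0(1)] card_of_ordLeq_infinite by blast
  then obtain y where "y \<in> X" "y \<notin> F {}"
    using 0(3)[of "{}"] by (meson empty_subsetI finite.emptyI rev_finite_subset subsetI)
  then show ?case
    by (intro exI[of _ "{y}"]) auto
next
  case (Suc k r X F)
  from Suc.prems(1) obtain s :: "'a rel" where s: "is_aleph k s" "r =o cardSuc s"
    by auto
  note cs = is_aleph_Card_order[OF s(1)]
  have "s <o r"
    using cardSuc_greater[OF cs] s(2) ordIso_symmetric ordLess_ordIso_trans by blast
  then have sX: "s <o |X|"
    using Suc.prems(2) ordLess_ordLeq_trans by blast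
  have fs: "|Field s| =o s"
    by (rule card_of_Field_ordIso[OF cs])
  then have "|Field s| \<le>o |X|"
    using sX ordIso_ordLess_trans ordLess_imp_ordLeq by blast
  then obtain Z where Z: "Z \<subseteq> X" "|Field s| =o |Z|"
    using iffD1[OF internalize_card_of_ordLeq2] by blast
  have sZ: "s =o |Z|"
    using fs Z(2) ordIso_symmetric ordIso_transitive by blast
  have infZ: "infinite Z"
    using infinite_Field_is_aleph[OF s(1)] Z(2) card_of_ordIso_finite by blast
  let ?U = "\<Union>C\<in>{C. C \<subseteq> Z \<and> finite C \<and> card C = Suc k}. F C"
  have "|?U| \<le>o |Z|"
  proof (rule card_of_UNION_ordLeq_infinite[OF infZ card_of_subsets_of_card_ordLeq[OF infZ]],
      intro ballI)
    fix C assume "C \<in> {C. C \<subseteq> Z \<and> finite C \<and> card C = Suc k}"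
    then have "finite (F C)"
      using Suc.prems(3) Z(1) by auto
    then show "|F C| \<le>o |Z|"
      using infZ by (metis card_of_ordLeq_finite card_of_Well_order ordLeq_total)
  qed
  then have "|Z \<union> ?U| \<le>o |Z|"
    using card_of_Un_ordLeq_infinite_Field[of "|Z|", OF _ card_of_mono1[OF subset_refl] _
        card_of_Card_order] infZ by (simp add: Field_card_of)
  then have "|Z \<union> ?U| <o |X|"
    using ordLeq_ordLess_trans ordIso_ordLess_trans[OF ordIso_symmetric[OF sZ] sX] by blast
  then have "\<not> X \<subseteq> Z \<union> ?U"
    using card_of_mono1 not_ordLess_ordLeq by blast
  then obtain y where y: "y \<in> X" "y \<notin> Z" "y \<notin> ?U"
    by blast
  have "finite (F (insert y D))" if "D \<subseteq> Z" "finite D" for D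
    using Suc.prems(3)[of "insert y D"] that y(1) Z(1) by auto
  then obtain W where W: "W \<subseteq> Z" "card W = Suc k" "\<forall>w\<in>W. w \<notin> F (insert y (W - {w}))"
    using Suc.IH[OF s(1) ordIso_imp_ordLeq[OF sZ], of "\<lambda>D. F (insert y D)"] by blast
  have finW: "finite W"
    using W(2) card.infinite by fastforce
  have "y \<notin> W" "y \<notin> F W"
    using y W(1,2) finW by auto
  moreover from this have "insert y W - {w} = insert y (W - {w})" if "w \<in> W" for w
    using that by blast
  ultimately have "\<forall>v\<in>insert y W. v \<notin> F (insert y W - {v})"
    using W(3) by auto
  moreover have "insert y W \<subseteq> X" "card (insert y W) = Suc (Suc k)"
    using y(1) W(1,2) Z(1) finW \<open>y \<notin> W\<close> by auto
  ultimately show ?case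
    by blast
qed

text \<open>
  Collecting the values of \<open>F\<close> on all subsets into one value reduces this to sets of the
  form \<open>Y - {y}\<close>: a set \<open>B \<subseteq> Y\<close> that misses \<open>y\<close> is a subset of \<open>Y - {y}\<close>.
\<close>

lemma bounded_free_set:
  fixes F :: "'a set \<Rightarrow> 'a set"
  assumes "card_ge_aleph (p - 1) X" and "m < p"
    and "\<And>B. B \<subseteq> X \<Longrightarrow> finite B \<Longrightarrow> finite (F B)"
  shows "\<exists>Y\<subseteq>X. card Y = p \<and> (\<forall>B\<subseteq>Y. card B \<le> m \<longrightarrow> F B \<inter> Y \<subseteq> B)"
proof -
  obtain r :: "'a rel" where r: "is_aleph (p - 1) r" "r \<le>o |X|"
    using assms(1) by (auto simp: card_ge_aleph_def)
  obtain Y where Y: "Y \<subseteq> X" "card Y = p" "\<forall>y\<in>Y. y \<notin> (\<Union>B\<in>Pow (Y - {y}). F B)"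
    using Kuratowski_free_set[OF r, of "\<lambda>C. \<Union>B\<in>Pow C. F B"] assms(2,3)
    by (auto simp: finite_subset)
  then have "F B \<inter> Y \<subseteq> B" if "B \<subseteq> Y" for B
    using that by blast
  with Y(1,2) show ?thesis
    by blast
qed

section \<open>Uniform continuity on finite sets\<close>

lemma sigma_set_subset_PiE: "sigma_set n X \<subseteq> (\<Pi>\<^sub>E x\<in>X. {0, 1})"
  using sigma_set_subset_cantor_cube[of n X] by (simp add: cantor_cube_def)

text \<open>
  Every point has a basic neighbourhood on which \<open>g\<close> varies by less than \<open>\<delta> / 2\<close>, and membership
  in it is decided by finitely many coordinates. By compactness finitely many such
  neighbourhoods suffice; \<open>F\<close> consists of all the coordinates that they use. Two points that agree
  on \<open>F\<close> then lie in a common neighbourhood.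
\<close>

lemma continuous_on_sigma_space_uniform:
  assumes g: "continuous_map (sigma_space n X) euclideanreal g" and "\<delta> > 0"
  shows "\<exists>F. finite F \<and> (\<forall>w\<in>sigma_set n X. \<forall>w'\<in>sigma_set n X.
    (\<forall>x\<in>F \<inter> X. w x = w' x) \<longrightarrow> \<bar>g w - g w'\<bar> < \<delta>)"
proof -
  let ?S = "sigma_set n X"
  let ?N = "\<lambda>F z. {w \<in> ?S. \<forall>x\<in>F. w x = z x}"
  have "\<exists>F. finite F \<and> F \<subseteq> X \<and> (\<forall>w\<in>?N F z. \<bar>g w - g z\<bar> < \<delta> / 2)" if z: "z \<in> ?S" for z
  proof -
    have "openin (sigma_space n X) {w \<in> topspace (sigma_space n X). g w \<in> ball (g z) (\<delta> / 2)}"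
      by (rule openin_continuous_map_preimage[OF g]) simp
    then obtain V where V: "openin (cantor_cube X) V" "{w \<in> ?S. g w \<in> ball (g z) (\<delta> / 2)} = V \<inter> ?S"
      unfolding topspace_sigma_space unfolding sigma_space_def openin_subtopology by blast
    have "z \<in> V"
    proof -
      have "z \<in> {w \<in> ?S. g w \<in> ball (g z) (\<delta> / 2)}"
        using z assms(2) by simp
      then show ?thesis
        unfolding V(2) by blast
    qed
    then obtain U where U: "finite {i \<in> X. U i \<noteq> {0, 1::nat}}" "z \<in> Pi\<^sub>E X U" "Pi\<^sub>E X U \<subseteq> V"
      using V(1) unfolding cantor_cube_def openin_product_topology_alt by fastforce
    let ?F = "{i \<in> X. U i \<noteq> {0, 1::nat}}"
    have PiE: "w \<in> Pi\<^sub>E X U" if w: "w \<in> ?N ?F z" for w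
    proof -
      have wc: "w \<in> (\<Pi>\<^sub>E x\<in>X. {0, 1})"
        using w sigma_set_subset_PiE by blast
      have "w x \<in> U x" if "x \<in> X" for x
        using w wc U(2) that PiE_mem[OF wc that] PiE_mem[OF U(2) that]
        by (cases "x \<in> ?F") auto
      with wc show ?thesis
        by (auto simp: PiE_def)
    qed
    have "\<bar>g w - g z\<bar> < \<delta> / 2" if w: "w \<in> ?N ?F z" for w
    proof -
      have "w \<in> V" "w \<in> ?S"
        using PiE[OF w] U(3) w by (blast, simp)
      then have "w \<in> {w \<in> ?S. g w \<in> ball (g z) (\<delta> / 2)}"
        unfolding V(2) by blast
      then show ?thesis
        by (simp add: dist_real_def abs_minus_commute)
    qed
    with U(1) show ?thesis
      by (intro exI[of _ ?F]) blast
  qed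
  then have "\<forall>z\<in>?S. \<exists>F. finite F \<and> F \<subseteq> X \<and> (\<forall>w\<in>?N F z. \<bar>g w - g z\<bar> < \<delta> / 2)"
    by (intro ballI)
  from bchoice[OF this] obtain F where F: "\<forall>z\<in>?S. finite (F z) \<and> F z \<subseteq> X \<and>
      (\<forall>w\<in>?N (F z) z. \<bar>g w - g z\<bar> < \<delta> / 2)"
    by (elim exE)
  note F = bspec[OF F]
  have "openin (sigma_space n X) (?N (F z) z)" if z: "z \<in> ?S" for z
  proof -
    have *: "continuous_map (sigma_space n X) (discrete_topology {0, 1}) (\<lambda>w. w x)" if "x \<in> X" for x
      using continuous_map_product_projection[OF that] continuous_map_from_subtopology
      unfolding sigma_space_def cantor_cube_def by blast
    have o: "openin (sigma_space n X) {w \<in> ?S. w x = z x}" if "x \<in> F z" for x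
    proof -
      have x: "x \<in> X"
        using F[OF z] that by blast
      have "z x \<in> {0, 1}"
        using PiE_mem[OF subsetD[OF sigma_set_subset_PiE z] x] .
      then have "openin (sigma_space n X) {w \<in> topspace (sigma_space n X). w x \<in> {z x}}"
        by (intro openin_continuous_map_preimage[OF *[OF x]]) simp
      then show ?thesis
        by simp
    qed
    have "?N (F z) z = topspace (sigma_space n X) \<inter> \<Inter>((\<lambda>x. {w \<in> ?S. w x = z x}) ` F z)"
      by auto
    also have "openin (sigma_space n X) \<dots>"
      using F[OF z] o openin_topspace by (intro openin_Int_Inter) blast+
    finally show ?thesis .
  qed
  then have "\<forall>U\<in>(\<lambda>z. ?N (F z) z) ` ?S. openin (sigma_space n X) U"
    by blast
  moreover have "topspace (sigma_space n X) \<subseteq> \<Union>((\<lambda>z. ?N (F z) z) ` ?S)"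
    by auto
  ultimately obtain \<F> where \<F>: "finite \<F>" "\<F> \<subseteq> (\<lambda>z. ?N (F z) z) ` ?S" "?S \<subseteq> \<Union>\<F>"
    using compact_sigma_space[of n X] unfolding compact_space_alt topspace_sigma_space by meson
  then obtain Q where Q: "Q \<subseteq> ?S" "finite Q" "\<F> = (\<lambda>z. ?N (F z) z) ` Q"
    by (meson finite_subset_image)
  let ?F = "\<Union>(F ` Q)"
  have "\<bar>g w - g w'\<bar> < \<delta>"
    if w: "w \<in> ?S" "w' \<in> ?S" "\<forall>x\<in>?F \<inter> X. w x = w' x" for w w'
  proof -
    obtain z where z: "z \<in> Q" "w \<in> ?N (F z) z"
      using w(1) \<F>(3) Q(3) by blast
    have "F z \<subseteq> ?F \<inter> X"
      using F[of z] z(1) Q(1) by blast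
    then have "w' \<in> ?N (F z) z"
      using z(2) w(2,3) by force
    then have "\<bar>g w - g z\<bar> < \<delta> / 2" "\<bar>g w' - g z\<bar> < \<delta> / 2"
      using F[of z] z Q(1) by blast+
    then show ?thesis
      by linarith
  qed
  moreover have "finite ?F"
    using Q F by auto
  ultimately show ?thesis
    by blast
qed


section \<open>Moebius coefficients and the canonical operator\<close>

text \<open>
  The coefficient of the monomial \<open>e\<^sub>D\<close> in the expansion of \<open>h\<close>, viewed as a function
  on finite sets, i.e. the Moebius transform of \<open>h\<close> on the subset lattice.
\<close>

definition moebius :: "('a set \<Rightarrow> real) \<Rightarrow> 'a set \<Rightarrow> real" where
  "moebius h D = (\<Sum>C\<in>Pow D. (-1) ^ (card D - card C) * h C)"

lemma sum_moebius_Pow: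
  assumes "finite S"
  shows "(\<Sum>D\<in>Pow S. moebius h D) = h S"
proof -
  define g where "g D = (\<Sum>C\<in>Pow D. (-1) ^ card C * h C)" for D
  have "moebius h D = (-1) ^ card D * g D" if "D \<subseteq> S" for D
  proof -
    have "finite D"
      using that assms finite_subset by blast
    then show ?thesis
      unfolding moebius_def g_def sum_distrib_left mult.assoc[symmetric] power_add[symmetric]
      by (intro sum.cong) (auto simp: neg_one_power_add_eq_neg_one_power_diff card_mono)
  qed
  moreover have "h S = (\<Sum>D\<in>Pow S. (-1) ^ card D * g D)"
    by (rule inclusion_exclusion_symmetric[OF g_def assms])
  ultimately show ?thesis
    by simp
qed

lemma abs_moebius_le:
  assumes "finite D" "\<And>C. C \<subseteq> D \<Longrightarrow> \<bar>h C\<bar> \<le> 1"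
  shows "\<bar>moebius h D\<bar> \<le> 2 ^ card D"
proof -
  have "\<bar>moebius h D\<bar> \<le> (\<Sum>C\<in>Pow D. \<bar>(-1) ^ (card D - card C) * h C\<bar>)"
    unfolding moebius_def by (rule sum_abs)
  also have "\<dots> \<le> (\<Sum>C\<in>Pow D. 1)"
    using assms(2) by (intro sum_mono) (auto simp: abs_mult power_abs)
  finally show ?thesis
    using assms(1) by (simp add: card_Pow)
qed

text \<open>
  Grouped by size, this is a partial alternating sum of a row of Pascal's triangle, which
  telescopes.
\<close>

lemma alternating_sum_small_subsets:
  assumes "finite S" "k < card S"
  shows "(\<Sum>E | E \<subseteq> S \<and> card E \<le> k. (-1) ^ card E) = (-1) ^ k * real ((card S - 1) choose k)"
proof -
  let ?P = "{E. E \<subseteq> S \<and> card E \<le> k}"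
  have "(\<Sum>E\<in>?P. (-1) ^ card E) = (\<Sum>i\<le>k. \<Sum>E\<in>{E \<in> ?P. card E = i}. (-1::real) ^ card E)"
    using assms(1) by (intro sum.group[symmetric]) auto
  also have "\<dots> = (\<Sum>i\<le>k. real (card S choose i) * (-1) ^ i)"
  proof (intro sum.cong refl)
    fix i assume "i \<in> {..k}"
    then have "{E \<in> ?P. card E = i} = {E. E \<subseteq> S \<and> card E = i}"
      by auto
    then show "(\<Sum>E\<in>{E \<in> ?P. card E = i}. (-1) ^ card E) = real (card S choose i) * (-1) ^ i"
      by (simp add: n_subsets[OF assms(1)])
  qed
  also have "\<dots> = (-1) ^ k * real ((card S - 1) choose k)"
    using gbinomial_sum_lower_neg[where a = "real (card S)" and m = k] assms(2)
    by (simp add: binomial_gbinomial of_nat_diff)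
  finally show ?thesis .
qed

text \<open>
  The coefficients of the canonical operator arise by exchanging the two sums over \<open>C \<subseteq> D\<close>: for
  fixed \<open>C\<close> the signs add up over the subsets \<open>D - C\<close> of \<open>A - C\<close> with at most \<open>m - |C|\<close> elements.
\<close>

lemma sum_moebius_small_subsets:
  assumes "finite A" "m < card A"
  shows "(\<Sum>D | D \<subseteq> A \<and> card D \<le> m. moebius h D) =
    (\<Sum>C | C \<subseteq> A \<and> card C \<le> m.
       (-1) ^ (m - card C) * real ((card A - card C - 1) choose (m - card C)) * h C)"
proof -
  let ?P = "{D. D \<subseteq> A \<and> card D \<le> m}"
  have fin: "finite ?P"
    using assms(1) by simp
  have fA: "finite D" if "D \<subseteq> A" for D
    using that assms(1) finite_subset by blast
  have "(\<Sum>D\<in>?P. moebius h D) = (\<Sum>D\<in>?P. \<Sum>C | C \<in> ?P \<and> C \<subseteq> D. (-1) ^ (card D - card C) * h C)"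
    unfolding moebius_def
    by (intro sum.cong refl) (auto intro: order_trans[OF card_mono[OF fA]])
  also have "\<dots> = (\<Sum>C\<in>?P. \<Sum>D | D \<in> ?P \<and> C \<subseteq> D. (-1) ^ (card D - card C) * h C)"
    by (rule sum.swap_restrict[OF fin fin])
  also have "\<dots> = (\<Sum>C\<in>?P. (-1) ^ (m - card C) * real ((card A - card C - 1) choose (m - card C)) * h C)"
  proof (intro sum.cong refl)
    fix C assume C: "C \<in> ?P"
    have cA: "card (A - C) = card A - card C"
      using C fA by (simp add: card_Diff_subset)
    have "(\<Sum>D | D \<in> ?P \<and> C \<subseteq> D. (-1) ^ (card D - card C)) =
        (\<Sum>E | E \<subseteq> A - C \<and> card E \<le> m - card C. (-1::real) ^ card E)"
    proof (rule sum.reindex_bij_witness[of _ "\<lambda>E. C \<union> E" "\<lambda>D. D - C"])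
      fix E assume E: "E \<in> {E. E \<subseteq> A - C \<and> card E \<le> m - card C}"
      have "card (C \<union> E) = card C + card E"
        using E C fA by (intro card_Un_disjoint) auto
      with E C show "C \<union> E \<in> {D \<in> ?P. C \<subseteq> D}"
        by auto
    qed (use C fA in \<open>auto simp: card_Diff_subset\<close>)
    also have "\<dots> = (-1) ^ (m - card C) * real ((card A - card C - 1) choose (m - card C))"
      using alternating_sum_small_subsets[of "A - C" "m - card C"] C assms cA by auto
    finally show "(\<Sum>D | D \<in> ?P \<and> C \<subseteq> D. (-1) ^ (card D - card C) * h C) =
        (-1) ^ (m - card C) * real ((card A - card C - 1) choose (m - card C)) * h C"
      by (simp add: sum_distrib_right[symmetric])
  qed
  finally show ?thesis .
qed

text \<open>
  Both cases of the definition are instances of one formula, the truncated expansion in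
  monomials; for \<open>|A| \<le> m\<close> the truncation is void and the formula is Moebius inversion.
\<close>

lemma canonical_operator_moebius:
  assumes "A \<subseteq> Y" "finite A" "card A \<le> n"
  shows "canonical_operator m n Y f (chi Y A) =
    (\<Sum>D | D \<subseteq> A \<and> card D \<le> m. moebius (\<lambda>C. f (chi Y C)) D)"
proof (cases "card A \<le> m")
  case True
  then have "{D. D \<subseteq> A \<and> card D \<le> m} = Pow A"
    using card_mono[OF assms(2)] by (auto intro: order_trans)
  then show ?thesis
    using True sum_moebius_Pow[OF assms(2), of "\<lambda>C. f (chi Y C)"]
    by (simp add: canonical_operator_chi[OF assms])
next
  case False
  then show ?thesis
    using sum_moebius_small_subsets[OF assms(2), of m "\<lambda>C. f (chi Y C)"]
    by (simp add: canonical_operator_chi[OF assms])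
qed

section \<open>Monomials on the spaces of finite sets\<close>

text \<open>
  The function \<open>e\<^sub>D\<close>, written as a product of coordinates so that its continuity is evident.
\<close>

definition set_monomial :: "nat \<Rightarrow> 'a set \<Rightarrow> 'a set \<Rightarrow> ('a \<Rightarrow> nat) \<Rightarrow> real" where
  "set_monomial m X D = (\<lambda>z\<in>sigma_set m X. \<Prod>x\<in>D. real (z x))"

lemma set_monomial_chi:
  assumes "A \<subseteq> X" "finite A" "card A \<le> m" "D \<subseteq> X" "finite D"
  shows "set_monomial m X D (chi X A) = of_bool (D \<subseteq> A)"
proof -
  have "(\<Prod>x\<in>D. real (chi X A x)) = (\<Prod>x\<in>D. of_bool (x \<in> A))"
    using assms(4) by (intro prod.cong) (auto simp: chi_def indicator_def)
  also have "\<dots> = of_bool (D \<subseteq> A)"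
    using assms(5) by (cases "D \<subseteq> A") (auto intro!: prod.neutral)
  finally show ?thesis
    using assms by (simp add: set_monomial_def chi_in_sigma_set)
qed

lemma set_monomial_in_cont_space:
  assumes "D \<subseteq> X" "finite D"
  shows "set_monomial m X D \<in> cont_space (sigma_space m X)"
proof -
  have "continuous_map (sigma_space m X) euclideanreal (\<lambda>z. real (z x))" if "x \<in> X" for x
  proof -
    have "continuous_map (sigma_space m X) (discrete_topology {0, 1}) (\<lambda>z. z x)"
      using continuous_map_product_projection[OF that] continuous_map_from_subtopology
      unfolding sigma_space_def cantor_cube_def by blast
    moreover have "continuous_map (discrete_topology {0, 1::nat}) euclideanreal real"
      by (simp add: continuous_map_from_discrete_topology)
    ultimately show ?thesis
      using continuous_map_compose[unfolded o_def] by blast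
  qed
  then have "continuous_map (sigma_space m X) euclideanreal (\<lambda>z. \<Prod>x\<in>D. real (z x))"
    using assms by (intro continuous_map_prod) auto
  then have "continuous_map (sigma_space m X) euclideanreal (set_monomial m X D)"
    by (rule continuous_map_eq) (simp add: set_monomial_def)
  then show ?thesis
    by (simp add: cont_space_def set_monomial_def)
qed

text \<open>
  By Moebius inversion \<open>f(\<chi>\<^bsub>A \<inter> Y\<^esub>)\<close> is the sum of the coefficients over \<open>D \<subseteq> A \<inter> Y\<close>; these are
  the \<open>D \<subseteq> Y\<close> whose monomial on \<open>\<sigma>\<^sub>m(2\<^sup>X)\<close> takes the value \<open>1\<close> at \<open>\<chi>\<^sub>A\<close>.
\<close>

lemma inflate_moebius:
  assumes "Y \<subseteq> X" "finite Y"
  shows "inflate m X Y f =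
    (\<lambda>z\<in>sigma_set m X. \<Sum>D | D \<subseteq> Y \<and> card D \<le> m.
       moebius (\<lambda>C. f (chi Y C)) D * set_monomial m X D z)"
proof (rule extensionalityI[where A = "sigma_set m X"])
  fix z assume "z \<in> sigma_set m X"
  then obtain A where A: "z = chi X A" "A \<subseteq> X" "finite A" "card A \<le> m"
    by (auto simp: sigma_set_def)
  let ?h = "\<lambda>C. f (chi Y C)"
  have small: "card D \<le> m" if "D \<subseteq> A" for D
    using card_mono[OF A(3) that] A(4) by simp
  have "(\<Sum>D | D \<subseteq> Y \<and> card D \<le> m. moebius ?h D * set_monomial m X D z) =
      (\<Sum>D | D \<subseteq> Y \<and> card D \<le> m. moebius ?h D * of_bool (D \<subseteq> A))"
    unfolding A(1) using assms A(2-4)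
    by (intro sum.cong refl) (auto simp: set_monomial_chi finite_subset)
  also have "\<dots> = (\<Sum>D\<in>Pow (A \<inter> Y). moebius ?h D)"
    using assms small by (intro sum.mono_neutral_cong_right) auto
  also have "\<dots> = f (chi Y (A \<inter> Y))"
    using A(3) by (subst sum_moebius_Pow) auto
  finally show "inflate m X Y f z = (\<lambda>z\<in>sigma_set m X. \<Sum>D | D \<subseteq> Y \<and> card D \<le> m.
       moebius ?h D * set_monomial m X D z) z"
    using A \<open>z \<in> sigma_set m X\<close> by (simp add: inflate_chi)
qed (auto simp: inflate_def)

lemma sum_in_cont_space:
  assumes "finite I" "\<And>i. i \<in> I \<Longrightarrow> h i \<in> cont_space L"
  shows "(\<lambda>x\<in>topspace L. \<Sum>i\<in>I. c i * h i x) \<in> cont_space L"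
proof -
  have "continuous_map L euclideanreal (\<lambda>x. \<Sum>i\<in>I. c i * h i x)"
    using assms by (intro continuous_map_sum continuous_map_real_mult_left)
      (auto simp: cont_space_def)
  then have "continuous_map L euclideanreal (\<lambda>x\<in>topspace L. \<Sum>i\<in>I. c i * h i x)"
    by (rule continuous_map_eq) simp
  then show ?thesis
    by (simp add: cont_space_def)
qed

lemma bounded_operator_sum:
  assumes T: "bounded_operator L K T" and "finite I"
    and "\<And>i. i \<in> I \<Longrightarrow> h i \<in> cont_space L"
  shows "T (\<lambda>x\<in>topspace L. \<Sum>i\<in>I. c i * h i x) = (\<lambda>y\<in>topspace K. \<Sum>i\<in>I. c i * T (h i) y)"
  using assms(2,3)
proof (induction I rule: finite_induct)
  case empty
  let ?z = "\<lambda>x\<in>topspace L. 0 :: real"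
  have "?z \<in> cont_space L"
    using sum_in_cont_space[of "{}"] by simp
  then have "T (\<lambda>x\<in>topspace L. 0 * ?z x) = (\<lambda>y\<in>topspace K. 0 * T ?z y)"
    using T unfolding bounded_operator_def by blast
  then show ?case
    by (simp add: restrict_def)
next
  case (insert i I)
  let ?a = "\<lambda>x\<in>topspace L. c i * h i x"
  let ?s = "\<lambda>x\<in>topspace L. \<Sum>i\<in>I. c i * h i x"
  have "?a \<in> cont_space L"
    using sum_in_cont_space[of "{i}" h L c] insert.prems by simp
  moreover have "?s \<in> cont_space L"
    using sum_in_cont_space[of I h L c] insert by simp
  ultimately have "T (\<lambda>x\<in>topspace L. ?a x + ?s x) = (\<lambda>y\<in>topspace K. T ?a y + T ?s y)"
    using T unfolding bounded_operator_def by blast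
  moreover have "(\<lambda>x\<in>topspace L. ?a x + ?s x) = (\<lambda>x\<in>topspace L. \<Sum>i\<in>insert i I. c i * h i x)"
    using insert.hyps by (auto simp: restrict_def)
  moreover have "T ?a = (\<lambda>y\<in>topspace K. c i * T (h i) y)"
    using T insert.prems unfolding bounded_operator_def by blast
  moreover have "T ?s = (\<lambda>y\<in>topspace K. \<Sum>i\<in>I. c i * T (h i) y)"
    using insert.IH insert.prems by blast
  ultimately show ?case
    using insert.hyps by (auto simp: restrict_def fun_eq_iff)
qed


section \<open>The operator on monomials and the norm of the difference\<close>

text \<open>
  If \<open>T e\<^sub>D\<close> depends on \<open>F\<close> only, up to \<open>\<delta>\<close>, then \<open>A\<close> may be replaced by its trace on \<open>F \<union> D\<close>.
  For \<open>A \<subseteq> Y\<close> and \<open>F \<inter> Y \<subseteq> D\<close> this trace is \<open>A \<inter> D\<close>, where \<open>T e\<^sub>D\<close> is known.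
  The set \<open>F\<close> is chosen before \<open>Y\<close>, which is what makes \<open>D \<mapsto> F\<close> a set mapping.
\<close>

lemma extension_operator_monomial_approx:
  assumes T: "extension_operator (sigma_space m X) (sigma_space n X) T"
    and "m < n" and "\<delta> > 0" and D: "D \<subseteq> X" "finite D"
  shows "\<exists>F. finite F \<and> (\<forall>Y A. Y \<subseteq> X \<longrightarrow> card D \<le> m \<longrightarrow> F \<inter> Y \<subseteq> D \<longrightarrow> A \<subseteq> Y \<longrightarrow> finite A \<longrightarrow>
    card A \<le> n \<longrightarrow> \<bar>T (set_monomial m X D) (chi X A) - of_bool (D \<subseteq> A)\<bar> < \<delta>)"
proof -
  let ?e = "set_monomial m X D"
  have e: "?e \<in> cont_space (sigma_space m X)"
    by (rule set_monomial_in_cont_space[OF D])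
  have "bounded_operator (sigma_space m X) (sigma_space n X) T"
    using T unfolding extension_operator_def by blast
  then have "continuous_map (sigma_space n X) euclideanreal (T ?e)"
    using e unfolding bounded_operator_def cont_space_def by blast
  then obtain F where F: "finite F" "\<And>w w'. w \<in> sigma_set n X \<Longrightarrow> w' \<in> sigma_set n X \<Longrightarrow>
      (\<And>x. x \<in> F \<inter> X \<Longrightarrow> w x = w' x) \<Longrightarrow> \<bar>T ?e w - T ?e w'\<bar> < \<delta>"
    using continuous_on_sigma_space_uniform \<open>\<delta> > 0\<close> by metis
  have "\<bar>T ?e (chi X A) - of_bool (D \<subseteq> A)\<bar> < \<delta>"
    if Y: "Y \<subseteq> X" "card D \<le> m" "F \<inter> Y \<subseteq> D" and A: "A \<subseteq> Y" "finite A" "card A \<le> n" for Y A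
  proof -
    let ?A = "A \<inter> (F \<union> D)"
    have sub: "?A \<subseteq> D" "?A \<subseteq> X" "finite ?A"
      using Y(1,3) A(1,2) by auto
    then have card: "card ?A \<le> m"
      using card_mono[OF D(2)] Y(2) order_trans by blast
    have "\<bar>T ?e (chi X A) - T ?e (chi X ?A)\<bar> < \<delta>"
    proof (rule F(2))
      show "chi X A \<in> sigma_set n X"
        using A Y(1) by (subst chi_in_sigma_set) auto
      show "chi X ?A \<in> sigma_set n X"
        using sub card \<open>m < n\<close> by (subst chi_in_sigma_set) auto
    qed (auto simp: chi_def indicator_def)
    moreover have "T ?e (chi X ?A) = ?e (chi X ?A)"
    proof -
      have "restrict (T ?e) (sigma_set m X) = ?e"
        using T e unfolding extension_operator_def topspace_sigma_space by blast
      moreover have "chi X ?A \<in> sigma_set m X"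
        using sub card by (subst chi_in_sigma_set) auto
      ultimately show ?thesis
        by (metis restrict_apply')
    qed
    moreover have "?e (chi X ?A) = of_bool (D \<subseteq> A)"
      using set_monomial_chi[OF sub(2,3) card D] by simp
    ultimately show ?thesis
      by simp
  qed
  with F(1) show ?thesis
    by blast
qed

lemma finite_sigma_set:
  assumes "finite Y"
  shows "finite (sigma_set n Y)"
proof -
  have "sigma_set n Y \<subseteq> chi Y ` Pow Y"
    by (auto simp: sigma_set_def)
  then show ?thesis
    using assms finite_subset by blast
qed

lemma restricted_operator_moebius:
  assumes T: "bounded_operator (sigma_space m X) (sigma_space n X) T"
    and Y: "Y \<subseteq> X" "finite Y" and A: "A \<subseteq> Y" "card A \<le> n"
  shows "restricted_operator m n X Y T f (chi Y A) =
    (\<Sum>D | D \<subseteq> Y \<and> card D \<le> m.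
       moebius (\<lambda>C. f (chi Y C)) D * T (set_monomial m X D) (chi X A))"
proof -
  let ?c = "moebius (\<lambda>C. f (chi Y C))"
  have fA: "finite A"
    using A(1) Y(2) finite_subset by blast
  have "set_monomial m X D \<in> cont_space (sigma_space m X)" if "D \<in> {D. D \<subseteq> Y \<and> card D \<le> m}" for D
    using that Y by (intro set_monomial_in_cont_space) (auto intro: finite_subset)
  moreover have "finite {D. D \<subseteq> Y \<and> card D \<le> m}"
    using Y(2) by simp
  ultimately have "T (inflate m X Y f) = (\<lambda>z\<in>sigma_set n X. \<Sum>D | D \<subseteq> Y \<and> card D \<le> m.
      ?c D * T (set_monomial m X D) z)"
    unfolding inflate_moebius[OF Y]
    using bounded_operator_sum[OF T, unfolded topspace_sigma_space] by blast
  moreover have "chi X A \<in> sigma_set n X"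
    using A fA Y(1) by (subst chi_in_sigma_set) auto
  ultimately show ?thesis
    using A fA by (simp add: restricted_operator_def deflate_chi)
qed

text \<open>
  The factor \<open>4 ^ card Y\<close> is the product of two bounds \<open>2 ^ card Y\<close>: one for the number of
  monomials, one for the coefficients of a function in the unit ball.
\<close>

lemma sup_norm_diff_le:
  assumes T: "bounded_operator (sigma_space m X) (sigma_space n X) T"
    and Y: "Y \<subseteq> X" "finite Y"
    and approx: "\<And>D A. D \<subseteq> Y \<Longrightarrow> card D \<le> m \<Longrightarrow> A \<subseteq> Y \<Longrightarrow> card A \<le> n \<Longrightarrow>
      \<bar>T (set_monomial m X D) (chi X A) - of_bool (D \<subseteq> A)\<bar> \<le> \<delta>"
    and f: "sup_norm (sigma_space m Y) f \<le> 1"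
  shows "sup_norm (sigma_space n Y) (operator_diff (sigma_space n Y)
    (restricted_operator m n X Y T) (canonical_operator m n Y) f) \<le> 4 ^ card Y * \<delta>"
proof -
  let ?c = "moebius (\<lambda>C. f (chi Y C))"
  let ?P = "{D. D \<subseteq> Y \<and> card D \<le> m}"
  have fin: "finite D" if "D \<subseteq> Y" for D
    using that Y(2) finite_subset by blast
  have f1: "\<bar>f (chi Y C)\<bar> \<le> 1" if "C \<subseteq> Y" "card C \<le> m" for C
  proof -
    have "\<bar>f (chi Y C)\<bar> \<le> sup_norm (sigma_space m Y) f"
      unfolding sup_norm_def using that fin finite_sigma_set[OF Y(2)]
      by (intro cSUP_upper) (auto simp: chi_in_sigma_set)
    with f show ?thesis
      by simp
  qed
  have c: "\<bar>?c D\<bar> \<le> 2 ^ card Y" if "D \<in> ?P" for D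
  proof -
    have "\<bar>?c D\<bar> \<le> 2 ^ card D"
    proof (rule abs_moebius_le)
      show "\<bar>f (chi Y C)\<bar> \<le> 1" if "C \<subseteq> D" for C
        using that \<open>D \<in> ?P\<close> card_mono[OF fin that] by (intro f1) auto
    qed (use that fin in auto)
    also have "\<dots> \<le> 2 ^ card Y"
      using that card_mono[OF Y(2)] by (intro power_increasing) auto
    finally show ?thesis .
  qed
  have "card ?P \<le> 2 ^ card Y"
    using card_mono[of "Pow Y" ?P] Y(2) by (auto simp: card_Pow)
  then have cP: "real (card ?P) \<le> 2 ^ card Y"
    by (metis of_nat_le_iff of_nat_numeral of_nat_power)
  have "0 \<le> \<delta>"
    using approx[of "{}" "{}"] by simp
  have main: "\<bar>restricted_operator m n X Y T f (chi Y A) - canonical_operator m n Y f (chi Y A)\<bar>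
      \<le> 4 ^ card Y * \<delta>" if A: "A \<subseteq> Y" "card A \<le> n" for A
  proof -
    let ?t = "\<lambda>D. T (set_monomial m X D) (chi X A)"
    have "canonical_operator m n Y f (chi Y A) = (\<Sum>D\<in>?P. ?c D * of_bool (D \<subseteq> A))"
      unfolding canonical_operator_moebius[OF A(1) fin[OF A(1)] A(2)] using A Y(2)
      by (intro sum.mono_neutral_cong_left) auto
    then have "\<bar>restricted_operator m n X Y T f (chi Y A) - canonical_operator m n Y f (chi Y A)\<bar>
        = \<bar>\<Sum>D\<in>?P. ?c D * (?t D - of_bool (D \<subseteq> A))\<bar>"
      by (simp only: restricted_operator_moebius[OF T Y A] right_diff_distrib sum_subtractf)
    also have "\<dots> \<le> (\<Sum>D\<in>?P. \<bar>?c D * (?t D - of_bool (D \<subseteq> A))\<bar>)"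
      by (rule sum_abs)
    also have "\<dots> \<le> (\<Sum>D\<in>?P. 2 ^ card Y * \<delta>)"
      unfolding abs_mult using c approx A \<open>0 \<le> \<delta>\<close> by (intro sum_mono mult_mono) auto
    also have "\<dots> = real (card ?P) * (2 ^ card Y * \<delta>)"
      by simp
    also have "\<dots> \<le> 2 ^ card Y * (2 ^ card Y * \<delta>)"
      using cP \<open>0 \<le> \<delta>\<close> by (intro mult_right_mono) auto
    also have "\<dots> = 4 ^ card Y * \<delta>"
      by (simp add: power_mult_distrib[symmetric])
    finally show ?thesis .
  qed
  \<comment> \<open>a supremum of reals is bounded by its terms only over a nonempty set\<close>
  have "chi Y {} \<in> sigma_set n Y"
    by (simp add: chi_in_sigma_set)
  then have "sigma_set n Y \<noteq> {}"
    by blast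
  then show ?thesis
    unfolding sup_norm_def
    by (intro cSUP_least) (auto simp: operator_diff_def sigma_set_def intro: main)
qed

lemma operator_norm_le:
  assumes "\<And>f. f \<in> cont_space L \<Longrightarrow> sup_norm L f \<le> 1 \<Longrightarrow> sup_norm K (T f) \<le> M"
    and "topspace L \<noteq> {}"
  shows "operator_norm L K T \<le> M"
proof -
  have "(\<lambda>x\<in>topspace L. 0) \<in> cont_space L"
    using sum_in_cont_space[of "{}"] by simp
  moreover have "sup_norm L (\<lambda>x\<in>topspace L. 0) \<le> 1"
    unfolding sup_norm_def using assms(2) by (intro cSUP_least) auto
  ultimately have "(\<lambda>x\<in>topspace L. 0) \<in> {f \<in> cont_space L. sup_norm L f \<le> 1}"
    by blast
  then show ?thesis
    unfolding operator_norm_def using assms(1) by (intro cSUP_least) blast+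
qed

theorem theorem3p7:
  fixes m n p :: nat and \<epsilon> :: real and X :: "'a set"
    and T :: "(('a \<Rightarrow> nat) \<Rightarrow> real) \<Rightarrow> (('a \<Rightarrow> nat) \<Rightarrow> real)"
  assumes "m < n" and "n \<le> p" and "\<epsilon> > 0"
    and "card_ge_aleph (p - 1) X"
    and "extension_operator (sigma_space m X) (sigma_space n X) T"
  shows "\<exists>Y. Y \<subseteq> X \<and> card Y = p \<and>
    operator_norm (sigma_space m Y) (sigma_space n Y)
      (operator_diff (sigma_space n Y) (restricted_operator m n X Y T) (canonical_operator m n Y))
      < \<epsilon>"
proof -
  have T: "bounded_operator (sigma_space m X) (sigma_space n X) T"
    using assms(5) unfolding extension_operator_def by blast
  \<comment> \<open>the factor \<open>2\<close> leaves room for the strict inequality after taking the supremum\<close>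
  define \<delta> where "\<delta> = \<epsilon> / (2 * 4 ^ p)"
  have "\<delta> > 0"
    using \<open>\<epsilon> > 0\<close> by (simp add: \<delta>_def)
  have "\<forall>D\<in>{D. D \<subseteq> X \<and> finite D}. \<exists>F. finite F \<and> (\<forall>Y A. Y \<subseteq> X \<longrightarrow> card D \<le> m \<longrightarrow> F \<inter> Y \<subseteq> D \<longrightarrow>
      A \<subseteq> Y \<longrightarrow> finite A \<longrightarrow> card A \<le> n \<longrightarrow>
      \<bar>T (set_monomial m X D) (chi X A) - of_bool (D \<subseteq> A)\<bar> < \<delta>)"
    using extension_operator_monomial_approx[OF assms(5,1) \<open>\<delta> > 0\<close>] by blast
  from bchoice[OF this] obtain F where "\<forall>D\<in>{D. D \<subseteq> X \<and> finite D}. finite (F D) \<and>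
      (\<forall>Y A. Y \<subseteq> X \<longrightarrow> card D \<le> m \<longrightarrow> F D \<inter> Y \<subseteq> D \<longrightarrow> A \<subseteq> Y \<longrightarrow> finite A \<longrightarrow> card A \<le> n \<longrightarrow>
      \<bar>T (set_monomial m X D) (chi X A) - of_bool (D \<subseteq> A)\<bar> < \<delta>)"
    by (elim exE)
  then have F: "\<And>D. D \<subseteq> X \<Longrightarrow> finite D \<Longrightarrow> finite (F D)"
    "\<And>D Y A. D \<subseteq> X \<Longrightarrow> finite D \<Longrightarrow> Y \<subseteq> X \<Longrightarrow> card D \<le> m \<Longrightarrow> F D \<inter> Y \<subseteq> D \<Longrightarrow> A \<subseteq> Y \<Longrightarrow>
      finite A \<Longrightarrow> card A \<le> n \<Longrightarrow> \<bar>T (set_monomial m X D) (chi X A) - of_bool (D \<subseteq> A)\<bar> < \<delta>"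
    by simp_all
  have "m < p"
    using assms(1,2) by simp
  have "\<exists>Y\<subseteq>X. card Y = p \<and> (\<forall>B\<subseteq>Y. card B \<le> m \<longrightarrow> F B \<inter> Y \<subseteq> B)"
    by (rule bounded_free_set[OF assms(4) \<open>m < p\<close>]) (rule F(1))
  then obtain Y where Y: "Y \<subseteq> X" "card Y = p" "\<And>B. B \<subseteq> Y \<Longrightarrow> card B \<le> m \<Longrightarrow> F B \<inter> Y \<subseteq> B"
    by blast
  have finY: "finite Y"
    using Y(2) \<open>m < p\<close> card.infinite by fastforce
  have approx: "\<bar>T (set_monomial m X D) (chi X A) - of_bool (D \<subseteq> A)\<bar> \<le> \<delta>"
    if "D \<subseteq> Y" "card D \<le> m" "A \<subseteq> Y" "card A \<le> n" for D A
  proof -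
    have "D \<subseteq> X" "finite D" "finite A"
      using that Y(1) finY finite_subset by blast+
    then show ?thesis
      using F(2)[OF _ _ Y(1) that(2) Y(3)[OF that(1,2)] that(3) _ that(4)] less_imp_le by blast
  qed
  have "sup_norm (sigma_space n Y) (operator_diff (sigma_space n Y)
      (restricted_operator m n X Y T) (canonical_operator m n Y) f) \<le> 4 ^ p * \<delta>"
    if "sup_norm (sigma_space m Y) f \<le> 1" for f
    using sup_norm_diff_le[OF T Y(1) finY approx that] Y(2) by simp
  moreover have "chi Y {} \<in> topspace (sigma_space m Y)"
    by (simp add: chi_in_sigma_set)
  ultimately have "operator_norm (sigma_space m Y) (sigma_space n Y)
      (operator_diff (sigma_space n Y) (restricted_operator m n X Y T) (canonical_operator m n Y))
      \<le> 4 ^ p * \<delta>"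
    by (intro operator_norm_le) blast+
  also have "\<dots> < \<epsilon>"
    using \<open>\<epsilon> > 0\<close> by (simp add: \<delta>_def)
  finally show ?thesis
    using Y(1,2) by blast
qed

end
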